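(* Let $S_{\boldsymbol\lambda}$ be a weighted shift on a directed tree $\mathcal{T}=(V,E)$ with weights $\boldsymbol\lambda=\{\lambda_v\}_{v\in V^\circ}\subseteq\mathbb{C}$. Suppose that $\mathscr{E}_V\subseteq\mathcal{D}^\infty(S_{\boldsymbol\lambda})$ and that $\{\|S_{\boldsymbol\lambda}^ne_u\|^2\}_{n=0}^\infty$ is a Stieltjes moment sequence for every $u\in V$. Then $\{\|S_{\boldsymbol\lambda}^nf\|^2\}_{n=0}^\infty$ is a Stieltjes moment sequence for every $f\in\mathcal{D}^\infty(S_{\boldsymbol\lambda})$.
   Context: $\mathbb{Z}_+=\{0,1,2,\ldots\}$, $\mathbb{R}_+=[0,\infty)$. A directed tree $\mathcal{T}=(V,E)$ is a nonempty directed graph (vertices $V$, edges $E\subseteq V\times V$) which is connected (as an undirected graph), has no circuits, and in which each vertex $v$ has at most one $u$ with $(u,v)\in E$; this $u$ is denoted $\mathrm{par}(v)$. A vertex with no parent is called the root (there is at most one). $V^\circ=V\setminus\{\text{root}\}$ if there is a root and $V^\circ=V$ otherwise. $\ell^2(V)$ is the complex Hilbert space of square summable complex functions on $V$; $e_u$ is the characteristic function of $\{u\}$; $\mathscr{E}_V$ is the linear span of $\{e_u\colon u\in V\}$. The weighted shift $S_{\boldsymbol\lambda}$ is the operator in $\ell^2(V)$ with $\mathcal{D}(S_{\boldsymbol\lambda})=\{f\in\ell^2(V)\colon\Lambda f\in\ell^2(V)\}$, $S_{\boldsymbol\lambda}f=\Lambda f$, where $(\Lambda f)(v)=\lambda_vf(\mathrm{par}(v))$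 for $v\in V^\circ$ and $(\Lambda f)(v)=0$ if $v$ is the root. $\mathcal{D}^\infty(A)=\bigcap_{n=0}^\infty\mathcal{D}(A^n)$. A sequence $\{\gamma_n\}_{n=0}^\infty\subseteq\mathbb{R}$ is a Stieltjes moment sequence if there is a positive Borel measure $\mu$ on $\mathbb{R}_+$ with $\gamma_n=\int_{\mathbb{R}_+}x^n\,d\mu(x)$ for all $n\in\mathbb{Z}_+$. *)

theory Defs
  imports
    "HOL-Analysis.Analysis"
    "HOL-Library.Function_Algebras"
    "Graph_Theory.Graph_Theory"
begin

section \<open>Directed trees\<close>

text \<open>
  The library's \<^const>\<open>tree\<close> means connected (as an undirected graph, with a nonempty vertex
  set) and without directed cycles; a loop counts as a cycle. The vertex set may be infinite, even
  uncountable.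
\<close>

locale directed_tree = pair_wf_digraph G for G :: "'a pair_pre_digraph" +
  assumes tree: "tree (with_proj G)"
    and parent_unique: "\<And>u u' v. (u, v) \<in> parcs G \<Longrightarrow> (u', v) \<in> parcs G \<Longrightarrow> u = u'"

text \<open>Meaningful only when \<open>v\<close> has a parent.\<close>

definition par :: "'a pair_pre_digraph \<Rightarrow> 'a \<Rightarrow> 'a" where
  "par G v = (THE u. (u, v) \<in> parcs G)"

definition is_root :: "'a pair_pre_digraph \<Rightarrow> 'a \<Rightarrow> bool" where
  "is_root G v \<longleftrightarrow> v \<in> pverts G \<and> (\<nexists>u. (u, v) \<in> parcs G)"

definition nonroots :: "'a pair_pre_digraph \<Rightarrow> 'a set" where
  "nonroots G = pverts G - {v. is_root G v}"


section \<open>The Hilbert space of square summable functions on a set\<close>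

text \<open>
  A function on \<open>V\<close> is represented by a function on the whole type that vanishes outside \<open>V\<close>.
\<close>

definition ell2 :: "'a set \<Rightarrow> ('a \<Rightarrow> complex) set" where
  "ell2 V = {f. (\<forall>v. v \<notin> V \<longrightarrow> f v = 0) \<and> (\<lambda>v. (cmod (f v))\<^sup>2) summable_on V}"

definition ell2_norm :: "'a set \<Rightarrow> ('a \<Rightarrow> complex) \<Rightarrow> real" where
  "ell2_norm V f = sqrt (\<Sum>\<^sub>\<infinity>v\<in>V. (cmod (f v))\<^sup>2)"

definition unit_fun :: "'a \<Rightarrow> 'a \<Rightarrow> complex" where
  "unit_fun u = indicator {u}"

definition cscale :: "complex \<Rightarrow> ('a \<Rightarrow> complex) \<Rightarrow> 'a \<Rightarrow> complex" where
  "cscale c f = (\<lambda>v. c * f v)"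

interpretation cfun: vector_space "cscale :: complex \<Rightarrow> ('a \<Rightarrow> complex) \<Rightarrow> 'a \<Rightarrow> complex"
  by unfold_locales (auto simp: cscale_def fun_eq_iff algebra_simps)

definition unit_span :: "'a set \<Rightarrow> ('a \<Rightarrow> complex) set" where
  "unit_span V = cfun.span (unit_fun ` V)"


section \<open>Unbounded operators and their powers\<close>

text \<open>
  A possibly unbounded operator is a partial map; its domain is \<^const>\<open>dom\<close> and products of
  operators, with their maximal domains, are given by \<^const>\<open>map_comp\<close>. The parameter \<open>H\<close> is the
  ambient space: the zeroth power of every operator is the identity on \<open>H\<close>.
\<close>

primrec op_power :: "'h set \<Rightarrow> ('h \<rightharpoonup> 'h) \<Rightarrow> nat \<Rightarrow> ('h \<rightharpoonup> 'h)" where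
  "op_power H A 0 = Some |` H"
| "op_power H A (Suc n) = A \<circ>\<^sub>m op_power H A n"

definition dom_infinity :: "'h set \<Rightarrow> ('h \<rightharpoonup> 'h) \<Rightarrow> 'h set" where
  "dom_infinity H A = (\<Inter>n. dom (op_power H A n))"


section \<open>Weighted shifts on directed trees\<close>

text \<open>Only the values of \<open>lam\<close> on \<^term>\<open>nonroots G\<close> matter.\<close>

definition shift_map ::
    "'a pair_pre_digraph \<Rightarrow> ('a \<Rightarrow> complex) \<Rightarrow> ('a \<Rightarrow> complex) \<Rightarrow> 'a \<Rightarrow> complex" where
  "shift_map G lam f v = (if v \<in> nonroots G then lam v * f (par G v) else 0)"

definition weighted_shift ::
    "'a pair_pre_digraph \<Rightarrow> ('a \<Rightarrow> complex) \<Rightarrow> ('a \<Rightarrow> complex) \<rightharpoonup> ('a \<Rightarrow> complex)" where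
  "weighted_shift G lam =
     (\<lambda>f. Some (shift_map G lam f)) |` {f \<in> ell2 (pverts G). shift_map G lam f \<in> ell2 (pverts G)}"

abbreviation shift_power ::
    "'a pair_pre_digraph \<Rightarrow> ('a \<Rightarrow> complex) \<Rightarrow> nat \<Rightarrow> ('a \<Rightarrow> complex) \<rightharpoonup> ('a \<Rightarrow> complex)" where
  "shift_power G lam \<equiv> op_power (ell2 (pverts G)) (weighted_shift G lam)"

abbreviation shift_dom_infinity ::
    "'a pair_pre_digraph \<Rightarrow> ('a \<Rightarrow> complex) \<Rightarrow> ('a \<Rightarrow> complex) set" where
  "shift_dom_infinity G lam \<equiv> dom_infinity (ell2 (pverts G)) (weighted_shift G lam)"

text \<open>Meaningful only when \<open>f\<close> lies in the domain of the \<open>n\<close>-th power.\<close>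

definition shift_norm_sq ::
    "'a pair_pre_digraph \<Rightarrow> ('a \<Rightarrow> complex) \<Rightarrow> ('a \<Rightarrow> complex) \<Rightarrow> nat \<Rightarrow> real" where
  "shift_norm_sq G lam f n = (ell2_norm (pverts G) (the (shift_power G lam n f)))\<^sup>2"


section \<open>Stieltjes moment sequences\<close>

definition stieltjes_moment_seq :: "(nat \<Rightarrow> real) \<Rightarrow> bool" where
  "stieltjes_moment_seq \<gamma> \<longleftrightarrow>
     (\<exists>\<mu> :: real measure. sets \<mu> = sets (restrict_space borel {0..}) \<and>
        (\<forall>n. has_bochner_integral \<mu> (\<lambda>x. x ^ n) (\<gamma> n)))"

end

theory Submission
  imports Defs
begin

text \<open>
  The value \<open>(\<Lambda>\<^sup>n f) v\<close> is a multiple, independent of \<open>f\<close>, of the value of \<open>f\<close> at the \<open>n\<close>-th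
  ancestor of \<open>v\<close>. Hence the functions \<open>\<Lambda>\<^sup>n e\<^sub>u\<close> have pairwise disjoint supports, and
  \<open>\<parallel>S\<^sup>n f\<parallel>\<^sup>2 = (\<Sum>u. \<bar>f u\<bar>\<^sup>2 \<parallel>S\<^sup>n e\<^sub>u\<parallel>\<^sup>2)\<close>. If \<open>\<mu>\<^sub>u\<close> represents the moments of \<open>e\<^sub>u\<close>, then the
  measure \<open>\<Sum>u. \<bar>f u\<bar>\<^sup>2 \<mu>\<^sub>u\<close> represents those of \<open>f\<close>.
\<close>

section \<open>Sums of arbitrary families of measures\<close>

text \<open>The sum over \<open>I\<close> is an integral against counting measure, so that
  uncountable index sets and infinite values are allowed. \<open>N\<close> supplies the
  sigma-algebra shared by the summands.\<close>

definition sum_measure :: "'i set \<Rightarrow> 'b measure \<Rightarrow> ('i \<Rightarrow> 'b measure) \<Rightarrow> 'b measure" where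
  "sum_measure I N M =
     measure_of (space N) (sets N) (\<lambda>A. \<integral>\<^sup>+i. emeasure (M i) A \<partial>count_space I)"

lemma sets_sum_measure [measurable_cong, simp]: "sets (sum_measure I N M) = sets N"
  by (simp add: sum_measure_def)

lemma space_sum_measure [simp]: "space (sum_measure I N M) = space N"
  by (simp add: sum_measure_def)

text \<open>Countable additivity is an interchange of a series with an integral over
  \<open>count_space I\<close>, where every function is measurable.\<close>

lemma emeasure_sum_measure:
  assumes "\<And>i. i \<in> I \<Longrightarrow> sets (M i) = sets N" and "A \<in> sets N"
  shows "emeasure (sum_measure I N M) A = (\<integral>\<^sup>+i. emeasure (M i) A \<partial>count_space I)"
proof (rule emeasure_measure_of[OF sum_measure_def])
  show "countably_additive (sets (sum_measure I N M))
          (\<lambda>A. \<integral>\<^sup>+i. emeasure (M i) A \<partial>count_space I)"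
  proof (rule countably_additiveI)
    fix F :: "nat \<Rightarrow> _"
    assume F: "range F \<subseteq> sets (sum_measure I N M)" "disjoint_family F"
    have "(\<Sum>n. \<integral>\<^sup>+i. emeasure (M i) (F n) \<partial>count_space I)
        = (\<integral>\<^sup>+i. (\<Sum>n. emeasure (M i) (F n)) \<partial>count_space I)"
      by (rule nn_integral_suminf[symmetric]) simp
    also have "\<dots> = (\<integral>\<^sup>+i. emeasure (M i) (\<Union>n. F n) \<partial>count_space I)"
      using F assms(1) by (intro nn_integral_cong suminf_emeasure) auto
    finally show "(\<Sum>n. \<integral>\<^sup>+i. emeasure (M i) (F n) \<partial>count_space I)
        = (\<integral>\<^sup>+i. emeasure (M i) (\<Union>n. F n) \<partial>count_space I)" .
  qed
qed (use assms in \<open>auto simp: positive_def dest: sets.sets_into_space\<close>)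

lemma nn_integral_sum_measure:
  assumes sets: "\<And>i. i \<in> I \<Longrightarrow> sets (M i) = sets N" and "g \<in> borel_measurable N"
  shows "(\<integral>\<^sup>+x. g x \<partial>sum_measure I N M) = (\<integral>\<^sup>+i. (\<integral>\<^sup>+x. g x \<partial>M i) \<partial>count_space I)"
  using assms(2)
proof (induction g rule: borel_measurable_induct)
  case (cong f g)
  have "(\<integral>\<^sup>+x. g x \<partial>M i) = (\<integral>\<^sup>+x. f x \<partial>M i)" if "i \<in> I" for i
    using cong sets_eq_imp_space_eq[OF sets[OF that]] by (intro nn_integral_cong) auto
  moreover have "(\<integral>\<^sup>+x. g x \<partial>sum_measure I N M) = (\<integral>\<^sup>+x. f x \<partial>sum_measure I N M)"
    using cong by (intro nn_integral_cong) auto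
  ultimately show ?case
    using cong by (simp cong: nn_integral_cong_simp)
next
  case (set A)
  then show ?case
    using sets by (simp add: emeasure_sum_measure cong: nn_integral_cong_simp)
next
  case (mult g c)
  have [measurable]: "g \<in> borel_measurable (M i)" if "i \<in> I" for i
    using mult sets[OF that] measurable_cong_sets by blast
  show ?case
    using mult by (simp add: nn_integral_cmult cong: nn_integral_cong_simp)
next
  case (add g h)
  have [measurable]: "g \<in> borel_measurable (M i)" "h \<in> borel_measurable (M i)" if "i \<in> I" for i
    using add sets[OF that] measurable_cong_sets by blast+
  show ?case
    using add by (simp add: nn_integral_add cong: nn_integral_cong_simp)
next
  case (seq U)
  have U: "U n \<in> borel_measurable (M i)" if "i \<in> I" for i n
    using seq sets[OF that] measurable_cong_sets by blast
  \<comment> \<open>Monotone convergence is applied three times: for the sum measure, for counting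
    measure on \<open>I\<close>, and for each \<open>M i\<close>.\<close>
  have "(\<integral>\<^sup>+x. (SUP n. U n) x \<partial>sum_measure I N M)
      = (SUP n. \<integral>\<^sup>+x. U n x \<partial>sum_measure I N M)"
    unfolding SUP_apply using seq by (intro nn_integral_monotone_convergence_SUP) auto
  also have "\<dots> = (SUP n. \<integral>\<^sup>+i. (\<integral>\<^sup>+x. U n x \<partial>M i) \<partial>count_space I)"
    using seq by simp
  also have "\<dots> = (\<integral>\<^sup>+i. (SUP n. \<integral>\<^sup>+x. U n x \<partial>M i) \<partial>count_space I)"
    using \<open>incseq U\<close>
    by (intro nn_integral_monotone_convergence_SUP[symmetric])
      (auto simp: incseq_def le_fun_def intro!: nn_integral_mono)
  also have "\<dots> = (\<integral>\<^sup>+i. (\<integral>\<^sup>+x. (SUP n. U n) x \<partial>M i) \<partial>count_space I)"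
    unfolding SUP_apply using seq U
    by (intro nn_integral_cong nn_integral_monotone_convergence_SUP[symmetric]) auto
  finally show ?case .
qed

section \<open>Stieltjes moment sequences\<close>

text \<open>Powers are nonnegative on the half-line, so a finite nonnegative integral already gives
  integrability. The hypothesis on \<open>\<gamma>\<close> matters because \<open>ennreal\<close>
  sends negative reals to 0.\<close>

lemma stieltjes_moment_seq_iff_nn_integral:
  assumes "\<And>n. 0 \<le> \<gamma> n"
  shows "stieltjes_moment_seq \<gamma> \<longleftrightarrow>
    (\<exists>\<mu> :: real measure. sets \<mu> = sets (restrict_space borel {0..}) \<and>
       (\<forall>n. (\<integral>\<^sup>+x. ennreal (x ^ n) \<partial>\<mu>) = ennreal (\<gamma> n)))"
proof -
  have "has_bochner_integral \<mu> (\<lambda>x. x ^ n) (\<gamma> n) \<longleftrightarrow>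
      (\<integral>\<^sup>+x. ennreal (x ^ n) \<partial>\<mu>) = ennreal (\<gamma> n)"
    if sets: "sets \<mu> = sets (restrict_space borel {0..})" for \<mu> :: "real measure" and n
  proof -
    have "space \<mu> = {0..}"
      using sets_eq_imp_space_eq[OF sets] by (simp add: space_restrict_space)
    then have nonneg: "AE x in \<mu>. 0 \<le> x ^ n"
      by (intro AE_I2) simp
    have "(\<lambda>x. x ^ n) \<in> borel_measurable (restrict_space borel {0 :: real..})"
      by (intro measurable_restrict_space1) simp
    then have meas: "(\<lambda>x. x ^ n) \<in> borel_measurable \<mu>"
      using sets measurable_cong_sets by blast
    show ?thesis
      using has_bochner_integral_nn_integral[OF meas nonneg assms]
        nn_integral_eq_integral[OF _ nonneg]
      by (auto simp: has_bochner_integral_iff)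
  qed
  then show ?thesis
    unfolding stieltjes_moment_seq_def by blast
qed

lemma stieltjes_moment_seq_infinite_combination:
  assumes moments: "\<And>u. u \<in> I \<Longrightarrow> stieltjes_moment_seq (\<gamma> u)"
    and nonneg: "\<And>u n. u \<in> I \<Longrightarrow> 0 \<le> \<gamma> u n" "\<And>n. 0 \<le> \<delta> n"
    and sum: "\<And>n. ennreal (\<delta> n) = (\<integral>\<^sup>+u. c u * ennreal (\<gamma> u n) \<partial>count_space I)"
  shows "stieltjes_moment_seq \<delta>"
proof -
  let ?N = "restrict_space borel {0 :: real..}"
  have "\<forall>u\<in>I. \<exists>\<mu>. sets \<mu> = sets ?N \<and> (\<forall>n. (\<integral>\<^sup>+x. ennreal (x ^ n) \<partial>\<mu>) = ennreal (\<gamma> u n))"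
    using moments nonneg(1) stieltjes_moment_seq_iff_nn_integral by blast
  then obtain \<mu> where sets: "\<And>u. u \<in> I \<Longrightarrow> sets (\<mu> u) = sets ?N"
    and int: "\<And>u n. u \<in> I \<Longrightarrow> (\<integral>\<^sup>+x. ennreal (x ^ n) \<partial>\<mu> u) = ennreal (\<gamma> u n)"
    by metis
  \<comment> \<open>The representing measure is the sum of the \<open>\<mu> u\<close> weighted by
    \<open>c u\<close>; its moments are finite because \<open>sum\<close> equates them with
    \<open>ennreal (\<delta> n)\<close>.\<close>
  let ?\<nu> = "sum_measure I ?N (\<lambda>u. scale_measure (c u) (\<mu> u))"
  have "(\<integral>\<^sup>+x. ennreal (x ^ n) \<partial>?\<nu>) = ennreal (\<delta> n)" for n
  proof -
    have meas: "(\<lambda>x. ennreal (x ^ n)) \<in> borel_measurable ?N"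
      by (intro measurable_restrict_space1) simp
    have meas': "(\<lambda>x. ennreal (x ^ n)) \<in> borel_measurable (\<mu> u)" if "u \<in> I" for u
      using meas sets[OF that] measurable_cong_sets by blast
    show ?thesis
      using sets meas'
      by (simp add: nn_integral_sum_measure[OF _ meas] nn_integral_scale_measure int sum
          cong: nn_integral_cong_simp)
  qed
  moreover have "sets ?\<nu> = sets ?N"
    by simp
  ultimately show ?thesis
    unfolding stieltjes_moment_seq_iff_nn_integral[of \<delta>, OF nonneg(2)] by blast
qed

section \<open>Sums over the vertex set\<close>

text \<open>Counting measure on an uncountable set is not sigma-finite. Extended by zero to
  \<open>UNIV\<close>, both iterated integrals equal the integral against counting measure on
  pairs.\<close>

lemma nn_integral_count_space_swap:
  "(\<integral>\<^sup>+x. (\<integral>\<^sup>+y. f x y \<partial>count_space B) \<partial>count_space A) =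
    (\<integral>\<^sup>+y. (\<integral>\<^sup>+x. f x y \<partial>count_space A) \<partial>count_space B)"
proof -
  let ?g = "\<lambda>(x, y). f x y * indicator A x * indicator B y"
  have "(\<integral>\<^sup>+x. (\<integral>\<^sup>+y. f x y \<partial>count_space B) \<partial>count_space A) =
      (\<integral>\<^sup>+x. (\<integral>\<^sup>+y. ?g (x, y) \<partial>count_space UNIV) \<partial>count_space UNIV)"
    by (auto simp: nn_integral_count_space_indicator split: split_indicator intro!: nn_integral_cong)
  also have "\<dots> = (\<integral>\<^sup>+y. (\<integral>\<^sup>+x. ?g (x, y) \<partial>count_space UNIV) \<partial>count_space UNIV)"
    by (simp only: nn_integral_fst_count_space nn_integral_snd_count_space)
  also have "\<dots> = (\<integral>\<^sup>+y. (\<integral>\<^sup>+x. f x y \<partial>count_space A) \<partial>count_space B)"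
    by (auto simp: nn_integral_count_space_indicator split: split_indicator intro!: nn_integral_cong)
  finally show ?thesis .
qed

text \<open>For nonnegative terms summability is absolute summability, where \<open>infsum\<close>
  agrees with the integral against counting measure.\<close>

lemma ennreal_ell2_norm_sq:
  assumes "f \<in> ell2 V"
  shows "ennreal ((ell2_norm V f)\<^sup>2) = (\<integral>\<^sup>+v. ennreal ((cmod (f v))\<^sup>2) \<partial>count_space V)"
proof -
  have "(\<lambda>v. (cmod (f v))\<^sup>2) summable_on V"
    using assms by (simp add: ell2_def)
  then have "Infinite_Set_Sum.abs_summable_on (\<lambda>v. (cmod (f v))\<^sup>2) V"
    by (simp flip: abs_summable_equivalent)
  then show ?thesis
    by (simp add: ell2_norm_def infsum_nonneg nn_integral_conv_infsetsum infsetsum_infsum)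
qed

lemma unit_fun_in_unit_span: "u \<in> V \<Longrightarrow> unit_fun u \<in> unit_span V"
  unfolding unit_span_def by (intro cfun.span_base) simp

section \<open>Powers of the weighted shift\<close>

text \<open>This reduces powers of the partial operator to iterates of the total map
  \<open>shift_map G lam\<close>.\<close>

lemma shift_power_SomeD:
  assumes "shift_power G lam n f = Some g"
  shows "g = (shift_map G lam ^^ n) f \<and> g \<in> ell2 (pverts G)"
  using assms
proof (induction n arbitrary: g)
  case 0
  then show ?case
    by (auto simp: restrict_map_def split: if_splits)
next
  case (Suc n)
  then obtain h where "shift_power G lam n f = Some h" "weighted_shift G lam h = Some g"
    by (auto simp: map_comp_Some_iff)
  then show ?case
    using Suc.IH[of h] by (auto simp: weighted_shift_def restrict_map_def split: if_splits)
qed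

lemma shift_dom_infinityD:
  assumes "f \<in> shift_dom_infinity G lam"
  shows "shift_power G lam n f = Some ((shift_map G lam ^^ n) f)"
    and "(shift_map G lam ^^ n) f \<in> ell2 (pverts G)"
proof -
  obtain g where "shift_power G lam n f = Some g"
    using assms by (auto simp: dom_infinity_def)
  then show "shift_power G lam n f = Some ((shift_map G lam ^^ n) f)"
    and "(shift_map G lam ^^ n) f \<in> ell2 (pverts G)"
    using shift_power_SomeD by blast+
qed

lemma shift_norm_sq_nonneg: "0 \<le> shift_norm_sq G lam f n"
  by (simp add: shift_norm_sq_def)

lemma ennreal_shift_norm_sq:
  assumes "f \<in> shift_dom_infinity G lam"
  shows "ennreal (shift_norm_sq G lam f n) =
    (\<integral>\<^sup>+v. ennreal ((cmod ((shift_map G lam ^^ n) f v))\<^sup>2) \<partial>count_space (pverts G))"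
  using shift_dom_infinityD[OF assms] by (simp add: shift_norm_sq_def ennreal_ell2_norm_sq)

text \<open>Each application looks one generation up, so \<open>w\<close> is the product of the
  weights met on the way from \<open>v\<close>. It is 0 if the way passes beyond the root, which
  makes the arbitrary value of \<open>par\<close> there harmless.\<close>

lemma funpow_shift_map_eq_mult:
  "\<exists>w. \<forall>f. (shift_map G lam ^^ n) f v = w * f ((par G ^^ n) v)"
proof (induction n arbitrary: v)
  case 0
  show ?case
    by (auto intro: exI[of _ 1])
next
  case (Suc n)
  obtain w where "\<And>f. (shift_map G lam ^^ n) f (par G v) = w * f ((par G ^^ n) (par G v))"
    using Suc.IH by blast
  then have "(shift_map G lam ^^ Suc n) f v =
      (if v \<in> nonroots G then lam v * w else 0) * f ((par G ^^ Suc n) v)" for f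
    by (simp add: shift_map_def[of G lam "(shift_map G lam ^^ n) f"] funpow_swap1[of "par G"])
  then show ?case
    by blast
qed

text \<open>At a fixed \<open>v\<close>, at most one \<open>u\<close> contributes: the
  \<open>n\<close>-th iterate of \<open>par G\<close> at \<open>v\<close>.\<close>

lemma funpow_shift_map_sq_eq_nn_integral:
  assumes "\<And>u. u \<notin> V \<Longrightarrow> f u = 0"
  shows "ennreal ((cmod ((shift_map G lam ^^ n) f v))\<^sup>2) =
    (\<integral>\<^sup>+u. ennreal ((cmod (f u))\<^sup>2) * ennreal ((cmod ((shift_map G lam ^^ n) (unit_fun u) v))\<^sup>2)
      \<partial>count_space V)"
    (is "?L = (\<integral>\<^sup>+u. ?R u \<partial>_)")
proof -
  let ?p = "(par G ^^ n) v"
  obtain w where w: "\<And>f. (shift_map G lam ^^ n) f v = w * f ?p"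
    using funpow_shift_map_eq_mult[of n G lam v] by blast
  have "?R u = ?L * indicator {?p} u" for u
    by (auto simp: w unit_fun_def norm_mult power_mult_distrib ennreal_mult mult.commute
        split: split_indicator)
  then have "(\<integral>\<^sup>+u. ?R u \<partial>count_space V) = ?L * emeasure (count_space V) ({?p} \<inter> V)"
    by (simp add: nn_integral_cmult nn_integral_indicator')
  \<comment> \<open>If \<open>?p\<close> lies outside \<open>V\<close>, the sum is empty and
    \<open>?L\<close> is 0 as well, since \<open>f ?p = 0\<close>.\<close>
  also have "\<dots> = ?L"
    using assms[of ?p] by (cases "?p \<in> V") (auto simp: w)
  finally show ?thesis
    by simp
qed

lemma shift_norm_sq_eq_nn_integral:
  assumes "unit_span (pverts G) \<subseteq> shift_dom_infinity G lam" and f: "f \<in> shift_dom_infinity G lam"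
  shows "ennreal (shift_norm_sq G lam f n) =
    (\<integral>\<^sup>+u. ennreal ((cmod (f u))\<^sup>2) * ennreal (shift_norm_sq G lam (unit_fun u) n)
      \<partial>count_space (pverts G))"
proof -
  let ?V = "count_space (pverts G)"
  let ?a = "\<lambda>u. ennreal ((cmod (f u))\<^sup>2)"
  let ?b = "\<lambda>f v. ennreal ((cmod ((shift_map G lam ^^ n) f v))\<^sup>2)"
  \<comment> \<open>The zeroth power is the identity on \<open>ell2 (pverts G)\<close>; hence
    \<open>f\<close> vanishes off the vertex set.\<close>
  have "f \<in> ell2 (pverts G)"
    using shift_dom_infinityD(2)[OF f, of 0] by simp
  then have "ennreal (shift_norm_sq G lam f n)
      = (\<integral>\<^sup>+v. (\<integral>\<^sup>+u. ?a u * ?b (unit_fun u) v \<partial>?V) \<partial>?V)"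
    unfolding ennreal_shift_norm_sq[OF f]
    by (intro nn_integral_cong funpow_shift_map_sq_eq_nn_integral) (auto simp: ell2_def)
  also have "\<dots> = (\<integral>\<^sup>+u. (\<integral>\<^sup>+v. ?a u * ?b (unit_fun u) v \<partial>?V) \<partial>?V)"
    by (rule nn_integral_count_space_swap)
  \<comment> \<open>The span hypothesis puts each \<open>unit_fun u\<close> into the domain of every
    power, so the inner sum is a squared norm.\<close>
  also have "\<dots> = (\<integral>\<^sup>+u. ?a u * ennreal (shift_norm_sq G lam (unit_fun u) n) \<partial>?V)"
    using assms(1)
    by (intro nn_integral_cong, subst ennreal_shift_norm_sq)
      (auto simp: nn_integral_cmult intro: unit_fun_in_unit_span)
  finally show ?thesis .
qed

theorem theorem3p2p4:
  fixes G :: "'a pair_pre_digraph" and lam :: "'a \<Rightarrow> complex"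
  assumes "directed_tree G"
    and "unit_span (pverts G) \<subseteq> shift_dom_infinity G lam"
    and "\<And>u. u \<in> pverts G \<Longrightarrow> stieltjes_moment_seq (shift_norm_sq G lam (unit_fun u))"
  shows "\<forall>f \<in> shift_dom_infinity G lam. stieltjes_moment_seq (shift_norm_sq G lam f)"
proof
  fix f
  assume "f \<in> shift_dom_infinity G lam"
  then show "stieltjes_moment_seq (shift_norm_sq G lam f)"
    \<comment> \<open>The weight \<open>c u\<close> is
      \<open>ennreal ((cmod (f u))\<^sup>2)\<close>, the same for all \<open>n\<close>, so one
      measure serves all moments.\<close>
    using stieltjes_moment_seq_infinite_combination[OF assms(3) _ _
        shift_norm_sq_eq_nn_integral[OF assms(2)]]
    by (simp add: shift_norm_sq_nonneg)
qed

end
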